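(* Let $G^\sigma$ be a connected oriented unicyclic graph and $C^\sigma$ its unique cycle. (1) If there exists a vertex $v\in V(C^\sigma)$ which is saturated in $G^\sigma\{v\}$, then $sr(G^\sigma)=sr(G^\sigma\{v\})+sr(G^\sigma-G^\sigma\{v\})$. (2) If no vertex $v\in V(C^\sigma)$ is saturated in $G^\sigma\{v\}$, then $sr(G^\sigma)=sr(C^\sigma)+sr(G^\sigma-C^\sigma)$.
   Context: An oriented graph $G^\sigma$ is a simple graph $G$ together with an orientation of each edge. Its skew-adjacency matrix $S(G^\sigma)=(s_{ij})$ has $s_{ij}=1$ if there is an arc from $v_i$ to $v_j$, $s_{ij}=-1$ if there is an arc from $v_j$ to $v_i$, and $0$ otherwise; the skew-rank $sr(\cdot)$ is the rank of the skew-adjacency matrix (of the induced oriented subgraph in question). For a vertex $v$ on the cycle, $G^\sigma\{v\}$ denotes the oriented tree rooted at $v$ containing $v$, i.e. the component containing $v$ of the graph obtained from $G^\sigma$ by deleting the edges of the cycle. A vertex $v$ of a tree $T$ is saturated in $T$ if every maximum matching of $T$ contains an edge incident with $v$, and unsaturated otherwise. $G^\sigma-H^\sigma$ denotes deletion of the vertices of $H^\sigma$ together with incident edges. *)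

theory Defs
  imports Main "Jordan_Normal_Form.DL_Rank"
begin

definition oriented_graph :: "'a set \<Rightarrow> ('a \<Rightarrow> 'a \<Rightarrow> bool) \<Rightarrow> bool" where
  "oriented_graph V Arc \<longleftrightarrow> finite V \<and>
     (\<forall>u v. Arc u v \<longrightarrow> u \<in> V \<and> v \<in> V) \<and>
     (\<forall>u. \<not> Arc u u) \<and> (\<forall>u v. Arc u v \<longrightarrow> \<not> Arc v u)"

definition adj :: "('a \<Rightarrow> 'a \<Rightarrow> bool) \<Rightarrow> 'a \<Rightarrow> 'a \<Rightarrow> bool" where
  "adj Arc u v \<longleftrightarrow> Arc u v \<or> Arc v u"

definition edges :: "('a \<Rightarrow> 'a \<Rightarrow> bool) \<Rightarrow> 'a set set" where
  "edges Arc = {{u, v} | u v. adj Arc u v}"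

definition connected_graph :: "'a set \<Rightarrow> ('a \<Rightarrow> 'a \<Rightarrow> bool) \<Rightarrow> bool" where
  "connected_graph V Arc \<longleftrightarrow> V \<noteq> {} \<and> (\<forall>u\<in>V. \<forall>v\<in>V. (adj Arc)\<^sup>*\<^sup>* u v)"

definition unicyclic :: "'a set \<Rightarrow> ('a \<Rightarrow> 'a \<Rightarrow> bool) \<Rightarrow> bool" where
  "unicyclic V Arc \<longleftrightarrow> connected_graph V Arc \<and> card (edges Arc) = card V"

definition is_cycle :: "('a \<Rightarrow> 'a \<Rightarrow> bool) \<Rightarrow> 'a list \<Rightarrow> bool" where
  "is_cycle Arc cs \<longleftrightarrow> length cs \<ge> 3 \<and> distinct cs \<and>
     (\<forall>i < length cs. adj Arc (cs ! i) (cs ! ((i + 1) mod length cs)))"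

definition cycle_edges :: "'a list \<Rightarrow> 'a set set" where
  "cycle_edges cs = {{cs ! i, cs ! ((i + 1) mod length cs)} | i. i < length cs}"

definition adj_minus_cycle :: "('a \<Rightarrow> 'a \<Rightarrow> bool) \<Rightarrow> 'a list \<Rightarrow> 'a \<Rightarrow> 'a \<Rightarrow> bool" where
  "adj_minus_cycle Arc cs u v \<longleftrightarrow> adj Arc u v \<and> {u, v} \<notin> cycle_edges cs"

definition rooted_tree :: "('a \<Rightarrow> 'a \<Rightarrow> bool) \<Rightarrow> 'a list \<Rightarrow> 'a \<Rightarrow> 'a set" where
  "rooted_tree Arc cs v = {u. (adj_minus_cycle Arc cs)\<^sup>*\<^sup>* v u}"

definition is_matching :: "'a set \<Rightarrow> ('a \<Rightarrow> 'a \<Rightarrow> bool) \<Rightarrow> 'a set set \<Rightarrow> bool" where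
  "is_matching T E M \<longleftrightarrow>
     (\<forall>e\<in>M. \<exists>u v. e = {u, v} \<and> u \<in> T \<and> v \<in> T \<and> E u v) \<and>
     (\<forall>e1\<in>M. \<forall>e2\<in>M. e1 \<noteq> e2 \<longrightarrow> e1 \<inter> e2 = {})"

definition is_max_matching :: "'a set \<Rightarrow> ('a \<Rightarrow> 'a \<Rightarrow> bool) \<Rightarrow> 'a set set \<Rightarrow> bool" where
  "is_max_matching T E M \<longleftrightarrow> is_matching T E M \<and> finite M \<and>
     (\<forall>M'. is_matching T E M' \<and> finite M' \<longrightarrow> card M' \<le> card M)"

definition saturated :: "'a set \<Rightarrow> ('a \<Rightarrow> 'a \<Rightarrow> bool) \<Rightarrow> 'a \<Rightarrow> bool" where
  "saturated T E v \<longleftrightarrow> (\<forall>M. is_max_matching T E M \<longrightarrow> (\<exists>e\<in>M. v \<in> e))"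

definition skew_entry :: "('a \<Rightarrow> 'a \<Rightarrow> bool) \<Rightarrow> 'a \<Rightarrow> 'a \<Rightarrow> real" where
  "skew_entry Arc u v = (if Arc u v then 1 else if Arc v u then -1 else 0)"

definition skew_mat :: "('a::linorder \<Rightarrow> 'a \<Rightarrow> bool) \<Rightarrow> 'a set \<Rightarrow> real mat" where
  "skew_mat Arc W = (let vs = sorted_list_of_set W in
     mat (length vs) (length vs) (\<lambda>(i, j). skew_entry Arc (vs ! i) (vs ! j)))"

definition skew_rank :: "('a::linorder \<Rightarrow> 'a \<Rightarrow> bool) \<Rightarrow> 'a set \<Rightarrow> nat" where
  "skew_rank Arc W = vec_space.rank (card W) (skew_mat Arc W)"

end

theory Submission
  imports Defs "Jordan_Normal_Form.Matrix_Kernel"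
begin

text \<open>Split the vertex set into \<open>A\<close> and \<open>B\<close> and write the skew-adjacency matrix in blocks. If
  the block \<open>S\<^sub>B\<^sub>A\<close> equals \<open>S\<^sub>B\<^sub>B Z\<close> and the Schur correction \<open>S\<^sub>A\<^sub>B Z\<close> vanishes, then the rank is the
  sum of the ranks of the diagonal blocks. Such a \<open>Z\<close> comes from the trees: in a tree \<open>T\<close> rooted at
  \<open>v\<close>, removing pendant edges one by one shows that \<open>S\<^sub>T x = e\<^sub>v\<close> is solvable if \<open>v\<close> is saturated,
  and that \<open>S\<^sub>T y = 0\<close> has a solution with \<open>y\<^sub>v = 1\<close> otherwise. In case (1) take \<open>B = T\<close>; only the
  column of \<open>v\<close> is linked to \<open>A\<close>, and the correction vanishes since \<open>x\<^sub>v = x\<^sup>T S\<^sub>T x = 0\<close> by skewness.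
  In case (2) let \<open>A\<close> be the cycle; the vectors \<open>y\<close> express the columns of the cycle vertices by
  columns of their trees.\<close>

subsection \<open>Rank and block elimination\<close>

text \<open>Rank-nullity for the linear map \<open>v \<mapsto> A *\<^sub>v v\<close>. It moves the
  problem from ranks to kernel dimensions, which are unchanged by invertible factors and add up over
  block-diagonal matrices.\<close>

lemma rank_plus_kernel_dim:
  fixes A :: "'a :: field mat"
  assumes A: "A \<in> carrier_mat nr nc"
  shows "vec_space.rank nr A + kernel.dim nc A = nc"
proof -
  interpret R: vec_space "TYPE('a)" nr .
  interpret C: vec_space "TYPE('a)" nc .
  interpret K: kernel nr nc A by unfold_locales (rule A)
  interpret L: linear_map class_ring "module_vec TYPE('a) nc" "module_vec TYPE('a) nr" "\<lambda>v. A *\<^sub>v v"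
    by unfold_locales
      (insert A, auto simp: LinearCombinations.module_hom_def module_vec_def
        mult_add_distrib_mat_vec[OF A] mult_mat_vec[OF A] class_ring_simps)
  have ker: "L.kerT = mat_kernel A"
    unfolding L.ker_def mat_kernel[OF A] by simp
  have im: "L.imT = R.span (set (cols A))"
    using R.col_space_eq[OF A] A unfolding R.col_space_def L.im_def by (auto simp: image_iff)
  have "C.dim = nc" by (rule C.dim_is_n)
  with L.rank_nullity[OF C.fin_dim] show ?thesis
    unfolding R.rank_def ker im by simp
qed

text \<open>Rows and columns are enumerated by separate lists, so one function on vertices can be
  read in sorted order or in block order. The permutation between the two orders then needs no
  separate treatment.\<close>

definition list_mat :: "'a list \<Rightarrow> 'b list \<Rightarrow> ('a \<Rightarrow> 'b \<Rightarrow> 'c) \<Rightarrow> 'c mat" where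
  "list_mat us vs F = mat (length us) (length vs) (\<lambda>(i, j). F (us ! i) (vs ! j))"

lemma list_mat_carrier: "list_mat us vs F \<in> carrier_mat (length us) (length vs)"
  by (simp add: list_mat_def)

lemma list_mat_cong:
  assumes "\<And>a b. a \<in> set us \<Longrightarrow> b \<in> set vs \<Longrightarrow> F a b = G a b"
  shows "list_mat us vs F = list_mat us vs G"
  using assms by (auto simp: list_mat_def intro!: eq_matI)

lemma list_mat_mult:
  fixes F :: "'a \<Rightarrow> 'b \<Rightarrow> 'd :: semiring_0"
  assumes "distinct vs"
  shows "list_mat us vs F * list_mat vs ws G = list_mat us ws (\<lambda>a c. \<Sum>b\<in>set vs. F a b * G b c)"
proof (rule eq_matI)
  fix i j
  assume "i < dim_row (list_mat us ws (\<lambda>a c. \<Sum>b\<in>set vs. F a b * G b c))"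
    and "j < dim_col (list_mat us ws (\<lambda>a c. \<Sum>b\<in>set vs. F a b * G b c))"
  then have ij: "i < length us" "j < length ws" by (auto simp: list_mat_def)
  have "(list_mat us vs F * list_mat vs ws G) $$ (i, j)
      = (\<Sum>k = 0..<length vs. F (us ! i) (vs ! k) * G (vs ! k) (ws ! j))"
    using ij by (simp add: list_mat_def scalar_prod_def)
  also have "\<dots> = (\<Sum>b\<in>set vs. F (us ! i) b * G b (ws ! j))"
    by (rule sum.reindex_bij_betw, rule bij_betw_nth) (use assms in \<open>auto simp: atLeast0LessThan\<close>)
  finally show "(list_mat us vs F * list_mat vs ws G) $$ (i, j)
      = list_mat us ws (\<lambda>a c. \<Sum>b\<in>set vs. F a b * G b c) $$ (i, j)"
    using ij by (simp add: list_mat_def)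
qed (simp_all add: list_mat_def)

lemma list_mat_one:
  assumes "distinct vs"
  shows "list_mat vs vs (\<lambda>a b. if a = b then 1 else 0) = 1\<^sub>m (length vs)"
  using assms by (auto simp: list_mat_def nth_eq_iff_index_eq intro!: eq_matI)

lemma list_mat_append_block_diagonal:
  assumes "set us \<inter> set vs = {}"
  shows "list_mat (us @ vs) (us @ vs) (\<lambda>a b. if a \<in> set us \<longleftrightarrow> b \<in> set us then F a b else 0)
    = four_block_mat (list_mat us us F) (0\<^sub>m (length us) (length vs))
        (0\<^sub>m (length vs) (length us)) (list_mat vs vs F)"
proof -
  have us: "us ! i \<in> set us" if "i < length us" for i
    using that by simp
  have vs: "vs ! i \<notin> set us" if "i < length vs" for i
    using that assms nth_mem by blast
  show ?thesis
    by (rule eq_matI) (auto simp: list_mat_def nth_append us vs)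
qed

text \<open>Block elimination: with \<open>P = 1 - Z\<close> the congruence \<open>P\<^sup>T S P\<close> removes both
  off-diagonal blocks of \<open>S\<close> while leaving its diagonal blocks unchanged.\<close>
lemma kernel_dim_list_mat_split:
  fixes S :: "'a \<Rightarrow> 'a \<Rightarrow> 'b :: field"
  assumes ws: "distinct ws" and us: "distinct us" and vs: "distinct vs"
    and disj: "set us \<inter> set vs = {}" and un: "set ws = set us \<union> set vs"
    and skew: "\<And>a b. S a b = - S b a"
    and col: "\<And>b a. b \<in> set vs \<Longrightarrow> a \<in> set us \<Longrightarrow> S b a = (\<Sum>b'\<in>set vs. S b b' * Z b' a)"
    and corner: "\<And>a a'. a \<in> set us \<Longrightarrow> a' \<in> set us \<Longrightarrow> (\<Sum>b\<in>set vs. S a b * Z b a') = 0"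
  shows "kernel.dim (length ws) (list_mat ws ws S)
    = kernel.dim (length us) (list_mat us us S) + kernel.dim (length vs) (list_mat vs vs S)"
proof -
  let ?n = "length ws" and ?xs = "us @ vs" and ?A = "set us" and ?B = "set vs"
  define I :: "'a \<Rightarrow> 'a \<Rightarrow> 'b" where "I a b = (if a = b then 1 else 0)" for a b
  \<comment> \<open>\<open>N\<close> is the block of \<open>Z\<close> with rows in \<open>?B\<close>
    and columns in \<open>?A\<close>. With P = 1 - N, the functions \<open>T\<close> and
    \<open>D\<close> describe S P and its product from the left with the transpose of P.\<close>
  define N where "N a b = (if a \<in> ?B \<and> b \<in> ?A then Z a b else 0)" for a b
  define T where "T a c = (if a \<in> ?B \<and> c \<in> ?A then 0 else S a c)" for a c
  define D where "D a c = (if a \<in> ?A \<longleftrightarrow> c \<in> ?A then S a c else 0)" for a c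
  have xs: "distinct ?xs" "set ?xs = ?A \<union> ?B" using us vs disj by auto
  have len: "length ?xs = ?n"
    using distinct_card[OF ws] distinct_card[OF xs(1)] xs(2) un by simp
  have I_left: "(\<Sum>b\<in>?A \<union> ?B. I a b * G b) = G a" if "a \<in> ?A \<union> ?B" for a and G :: "'a \<Rightarrow> 'b"
    using that by (simp add: I_def if_distrib[of "\<lambda>x. x * _"] sum.delta cong: if_cong)
  have I_right: "(\<Sum>b\<in>?A \<union> ?B. G b * I b c) = G c" if "c \<in> ?A \<union> ?B" for c and G :: "'a \<Rightarrow> 'b"
    using that by (simp add: I_def if_distrib[of "\<lambda>x. _ * x"] sum.delta' cong: if_cong)
  have N_right: "(\<Sum>b\<in>?A \<union> ?B. G b * N b c) = (if c \<in> ?A then \<Sum>b\<in>?B. G b * Z b c else 0)"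
    for c and G :: "'a \<Rightarrow> 'b"
    using disj by (subst sum.union_disjoint) (auto simp: N_def intro!: sum.neutral)
  \<comment> \<open>\<open>N\<close> maps coordinates of \<open>?A\<close> to coordinates of
    \<open>?B\<close> only, so its square is zero and 1 + N inverts 1 - N.\<close>
  have NN: "N a b * N b c = 0" for a b c using disj by (auto simp: N_def)
  have inv1: "(\<Sum>b\<in>?A \<union> ?B. (I a b - N a b) * (I b c + N b c)) = I a c"
    if "a \<in> ?A \<union> ?B" "c \<in> ?A \<union> ?B" for a c
  proof -
    have "(\<Sum>b\<in>?A \<union> ?B. (I a b - N a b) * (I b c + N b c))
      = (\<Sum>b\<in>?A \<union> ?B. I a b * I b c) + (\<Sum>b\<in>?A \<union> ?B. I a b * N b c)
        - (\<Sum>b\<in>?A \<union> ?B. N a b * I b c)"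
      by (simp add: distrib_left left_diff_distrib NN sum.distrib sum_subtractf)
    then show ?thesis using that by (simp add: I_left I_right)
  qed
  have SP: "(\<Sum>b\<in>?A \<union> ?B. S a b * (I b c - N b c)) = T a c"
    if "a \<in> ?A \<union> ?B" "c \<in> ?A \<union> ?B" for a c
  proof -
    have "(\<Sum>b\<in>?A \<union> ?B. S a b * (I b c - N b c))
        = (\<Sum>b\<in>?A \<union> ?B. S a b * I b c) - (\<Sum>b\<in>?A \<union> ?B. S a b * N b c)"
      by (simp add: right_diff_distrib sum_subtractf)
    also have "\<dots> = S a c - (if c \<in> ?A then \<Sum>b\<in>?B. S a b * Z b c else 0)"
      using that by (simp add: I_right N_right)
    also have "\<dots> = T a c"
      using that disj col[of a c] corner[of a c] by (auto simp: T_def)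
    finally show ?thesis .
  qed
  have PT: "(\<Sum>b\<in>?A \<union> ?B. (I b a - N b a) * T b c) = D a c"
    if "a \<in> ?A \<union> ?B" "c \<in> ?A \<union> ?B" for a c
  proof -
    have "(\<Sum>b\<in>?A \<union> ?B. (I b a - N b a) * T b c)
        = (\<Sum>b\<in>?A \<union> ?B. T b c * I b a) - (\<Sum>b\<in>?A \<union> ?B. T b c * N b a)"
      unfolding sum_subtractf[symmetric] by (rule sum.cong) (simp_all add: algebra_simps)
    also have "\<dots> = T a c - (if a \<in> ?A then \<Sum>b\<in>?B. T b c * Z b a else 0)"
      using that by (simp add: I_right N_right)
    also have "\<dots> = D a c"
    proof (cases "a \<in> ?A \<and> c \<in> ?B")
      \<comment> \<open>This is the upper right block. Here \<open>T\<close> agrees with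
        \<open>S\<close>, and skew-symmetry turns the column condition \<open>col\<close> into the
        row condition that clears the block.\<close>
      case True
      have "(\<Sum>b\<in>?B. T b c * Z b a) = (\<Sum>b\<in>?B. - (S c b * Z b a))"
      proof (rule sum.cong)
        fix b assume "b \<in> ?B"
        then show "T b c * Z b a = - (S c b * Z b a)"
          using True disj skew[of b c] by (auto simp: T_def)
      qed simp
      also have "\<dots> = S a c" using True col[of c a] skew[of a c] by (simp add: sum_negf)
      finally show ?thesis using True disj by (auto simp: T_def D_def)
    next
      case False
      then show ?thesis using that disj by (auto simp: T_def D_def intro!: sum.neutral)
    qed
    finally show ?thesis .
  qed
  \<comment> \<open>\<open>?P\<close> and \<open>?P'\<close> are mutually inverse, \<open>?Q\<close>
    and \<open>?Q'\<close> are their transposes. The index lists \<open>ws\<close> and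
    \<open>?xs\<close> differ, so these matrices also carry out the reordering of the
    vertices.\<close>
  let ?P = "list_mat ws ?xs (\<lambda>b c. I b c - N b c)"
  let ?P' = "list_mat ?xs ws (\<lambda>b c. I b c + N b c)"
  let ?Q = "list_mat ?xs ws (\<lambda>a b. I b a - N b a)"
  let ?Q' = "list_mat ws ?xs (\<lambda>a b. I b a + N b a)"
  have c: "?P \<in> carrier_mat ?n ?n" "?P' \<in> carrier_mat ?n ?n" "?Q \<in> carrier_mat ?n ?n"
    "?Q' \<in> carrier_mat ?n ?n" "list_mat ws ws S \<in> carrier_mat ?n ?n"
    "list_mat ws ?xs T \<in> carrier_mat ?n ?n"
    using len by (simp_all add: list_mat_def)
  have one: "list_mat ws ws I = 1\<^sub>m ?n"
    unfolding I_def using list_mat_one[OF ws] .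
  have PP': "?P * ?P' = 1\<^sub>m ?n"
    unfolding list_mat_mult[OF xs(1)] xs(2) one[symmetric]
    by (rule list_mat_cong) (use un inv1 in auto)
  have Q'Q: "?Q' * ?Q = 1\<^sub>m ?n"
    unfolding list_mat_mult[OF xs(1)] xs(2) one[symmetric]
  proof (rule list_mat_cong)
    fix a c assume "a \<in> set ws" "c \<in> set ws"
    then show "(\<Sum>b\<in>?A \<union> ?B. (I b a + N b a) * (I c b - N c b)) = I a c"
      using inv1[of c a] un by (simp add: mult.commute) (simp add: I_def)
  qed
  have SP': "list_mat ws ws S * ?P = list_mat ws ?xs T"
    unfolding list_mat_mult[OF ws] un by (rule list_mat_cong) (use un SP in auto)
  have QT: "?Q * list_mat ws ?xs T = list_mat ?xs ?xs D"
    unfolding list_mat_mult[OF ws] un by (rule list_mat_cong) (use un PT in auto)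
  have "kernel.dim ?n (list_mat ws ws S) = kernel.dim ?n (list_mat ws ?xs T)"
    using mat_kernel_dim_mult_eq_right[OF c(5,1,2) PP'] SP' by simp
  also have "\<dots> = kernel.dim ?n (list_mat ?xs ?xs D)"
    using mat_kernel_mult_eq[OF c(6,3,4) Q'Q] QT by simp
  also have "\<dots> = kernel.dim (length us) (list_mat us us S) + kernel.dim (length vs) (list_mat vs vs S)"
    using kernel_four_block_0_mat[OF list_mat_append_block_diagonal[OF disj, of S] list_mat_carrier list_mat_carrier]
      len unfolding D_def by simp
  finally show ?thesis .
qed

section \<open>Skew-rank of a partitioned vertex set\<close>

lemma skew_rank_plus_kernel_dim:
  assumes "finite W"
  shows "skew_rank Arc W + kernel.dim (card W)
    (list_mat (sorted_list_of_set W) (sorted_list_of_set W) (skew_entry Arc)) = card W"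
proof -
  let ?vs = "sorted_list_of_set W"
  have "length ?vs = card W" by simp
  then have "list_mat ?vs ?vs (skew_entry Arc) \<in> carrier_mat (card W) (card W)"
    using list_mat_carrier by metis
  from rank_plus_kernel_dim[OF this] show ?thesis
    by (simp add: skew_rank_def skew_mat_def list_mat_def Let_def)
qed

text \<open>Cardinalities and kernel dimensions both add up over the two parts, hence so do the
  ranks. Both cases of the theorem are instances of this, with different \<open>Z\<close>.\<close>

lemma skew_rank_split:
  assumes fin: "finite A" "finite B" and disj: "A \<inter> B = {}"
    and asym: "\<And>u v. Arc u v \<Longrightarrow> \<not> Arc v u"
    and col: "\<And>b a. b \<in> B \<Longrightarrow> a \<in> A \<Longrightarrow>
      skew_entry Arc b a = (\<Sum>b'\<in>B. skew_entry Arc b b' * Z b' a)"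
    and corner: "\<And>a a'. a \<in> A \<Longrightarrow> a' \<in> A \<Longrightarrow> (\<Sum>b\<in>B. skew_entry Arc a b * Z b a') = 0"
  shows "skew_rank Arc (A \<union> B) = skew_rank Arc A + skew_rank Arc B"
proof -
  have skew: "skew_entry Arc a b = - skew_entry Arc b a" for a b
    using asym by (auto simp: skew_entry_def)
  let ?K = "\<lambda>W. kernel.dim (length (sorted_list_of_set W))
    (list_mat (sorted_list_of_set W) (sorted_list_of_set W) (skew_entry Arc))"
  have "?K (A \<union> B) = ?K A + ?K B"
    by (rule kernel_dim_list_mat_split[where Z = Z]) (fact skew | use fin disj col corner in simp)+
  with skew_rank_plus_kernel_dim[of "A \<union> B" Arc] skew_rank_plus_kernel_dim[of A Arc]
    skew_rank_plus_kernel_dim[of B Arc] fin card_Un_disjoint[OF fin disj]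
  show ?thesis by simp
qed

subsection \<open>Saturated vertices of forests\<close>

lemma matching_edgeE:
  assumes "is_matching W E M" "e \<in> M"
  obtains x y where "e = {x, y}" "x \<in> W" "y \<in> W" "E x y"
  using assms unfolding is_matching_def by meson

lemma matching_disjoint:
  assumes "is_matching W E M" "e1 \<in> M" "e2 \<in> M" "x \<in> e1" "x \<in> e2"
  shows "e1 = e2"
  using assms unfolding is_matching_def by (meson disjoint_iff)

lemma matchingI:
  assumes "\<And>e. e \<in> M \<Longrightarrow> \<exists>x y. e = {x, y} \<and> x \<in> W \<and> y \<in> W \<and> E x y"
    and "\<And>e1 e2 x. e1 \<in> M \<Longrightarrow> e2 \<in> M \<Longrightarrow> x \<in> e1 \<Longrightarrow> x \<in> e2 \<Longrightarrow> e1 = e2"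
  shows "is_matching W E M"
  using assms unfolding is_matching_def by (meson disjoint_iff)

lemma matching_no_edges:
  assumes "\<And>a b. a \<in> W \<Longrightarrow> b \<in> W \<Longrightarrow> \<not> E a b" "is_matching W E M"
  shows "M = {}"
proof (rule ccontr)
  assume "M \<noteq> {}"
  then obtain e where "e \<in> M" by blast
  with assms(2) obtain a b where "a \<in> W" "b \<in> W" "E a b" by (rule matching_edgeE)
  with assms(1) show False by blast
qed

lemma not_saturated_no_edges:
  assumes "\<And>a b. a \<in> W \<Longrightarrow> b \<in> W \<Longrightarrow> \<not> E a b"
  shows "\<not> saturated W E v"
proof -
  have "is_max_matching W E {}"
    using matching_no_edges[of W E] assms unfolding is_max_matching_def
    by (auto simp: is_matching_def)
  then show ?thesis unfolding saturated_def by blast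
qed

lemma matching_insert_edge:
  assumes M: "is_matching W E M" and W: "W \<subseteq> W'" and e: "l \<in> W'" "u \<in> W'" "E l u"
    and free: "\<And>e. e \<in> M \<Longrightarrow> l \<notin> e" "\<And>e. e \<in> M \<Longrightarrow> u \<notin> e"
  shows "is_matching W' E (insert {l, u} M)" "{l, u} \<notin> M"
proof -
  have edge: "\<exists>x y. e = {x, y} \<and> x \<in> W' \<and> y \<in> W' \<and> E x y" if "e \<in> insert {l, u} M" for e
  proof (cases "e = {l, u}")
    case True
    with e show ?thesis by blast
  next
    case False
    with that have "e \<in> M" by blast
    with M obtain x y where "e = {x, y}" "x \<in> W" "y \<in> W" "E x y" by (rule matching_edgeE)
    with W show ?thesis by blast
  qed
  moreover have "e1 = e2" if "e1 \<in> insert {l, u} M" "e2 \<in> insert {l, u} M" "x \<in> e1" "x \<in> e2" for e1 e2 x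
    using that free matching_disjoint[OF M] by blast
  ultimately show "is_matching W' E (insert {l, u} M)" by (rule matchingI)
  show "{l, u} \<notin> M" using free by blast
qed

text \<open>The vertex \<open>l\<close> has \<open>u\<close> as its only neighbour inside
  \<open>W\<close>; neighbours outside \<open>W\<close> are allowed. This suits an induction in
  which \<open>W\<close> shrinks while \<open>E\<close> stays fixed.\<close>

locale pendant =
  fixes W :: "'a set" and E :: "'a \<Rightarrow> 'a \<Rightarrow> bool" and l u :: 'a
  assumes l: "l \<in> W" and u: "u \<in> W" and neq: "l \<noteq> u"
    and sym: "\<And>a b. E a b \<Longrightarrow> E b a"
    and leaf: "\<And>w. w \<in> W \<Longrightarrow> E l w \<longleftrightarrow> w = u"
begin

lemma leaf_edge:
  assumes "is_matching W E M" "e \<in> M" "l \<in> e"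
  shows "e = {l, u}"
proof -
  obtain x y where xy: "e = {x, y}" "x \<in> W" "y \<in> W" "E x y"
    using assms matching_edgeE by metis
  then consider "x = l" | "y = l" using assms(3) by blast
  then show ?thesis using xy leaf sym by cases blast+
qed

text \<open>A matching that misses \<open>u\<close> also misses \<open>l\<close>, whose only
  possible edge is \<open>{l, u}\<close>; adding this edge gives a larger matching.\<close>

lemma saturated_neighbour: "saturated W E u"
  unfolding saturated_def
proof (intro allI impI)
  fix M assume max: "is_max_matching W E M"
  show "\<exists>e\<in>M. u \<in> e"
  proof (rule ccontr)
    assume no: "\<not> (\<exists>e\<in>M. u \<in> e)"
    have M: "is_matching W E M" "finite M" using max unfolding is_max_matching_def by auto
    have nol: "l \<notin> e" if "e \<in> M" for e using leaf_edge[OF M(1) that] no that by blast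
    have lu: "E l u" using leaf u by blast
    have "is_matching W E (insert {l, u} M)" "{l, u} \<notin> M"
      using matching_insert_edge[OF M(1) order_refl l u lu] nol no by blast+
    then have "card (insert {l, u} M) \<le> card M" "card (insert {l, u} M) = Suc (card M)"
      using max M(2) unfolding is_max_matching_def by auto
    then show False by simp
  qed
qed

lemma matching_extend:
  assumes "is_matching (W - {l, u}) E M"
  shows "is_matching W E (insert {l, u} M)" "{l, u} \<notin> M"
proof -
  have "l \<notin> e \<and> u \<notin> e" if "e \<in> M" for e
  proof -
    obtain x y where "e = {x, y}" "x \<in> W - {l, u}" "y \<in> W - {l, u}" "E x y"
      using assms \<open>e \<in> M\<close> by (rule matching_edgeE)
    then show ?thesis by blast
  qed
  moreover have "E l u" using leaf u by blast
  ultimately show "is_matching W E (insert {l, u} M)" "{l, u} \<notin> M"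
    using matching_insert_edge[OF assms, of W l u] l u by blast+
qed

text \<open>An edge at \<open>l\<close> is also an edge at \<open>u\<close>. Hence dropping the
  edges at \<open>u\<close>, of which there is at most one, frees both vertices.\<close>

lemma matching_restrict:
  assumes M: "is_matching W E M" "finite M"
  defines "N \<equiv> {e \<in> M. u \<notin> e}"
  shows "is_matching (W - {l, u}) E N" "card M \<le> Suc (card N)"
proof -
  have l: "l \<notin> e" if "e \<in> N" for e using leaf_edge[OF M(1), of e] that unfolding N_def by blast
  have "\<exists>x y. e = {x, y} \<and> x \<in> W - {l, u} \<and> y \<in> W - {l, u} \<and> E x y" if "e \<in> N" for e
  proof -
    from that have "e \<in> M" by (simp add: N_def)
    with M(1) obtain x y where "e = {x, y}" "x \<in> W" "y \<in> W" "E x y" by (rule matching_edgeE)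
    moreover have "l \<notin> e" "u \<notin> e" using l that unfolding N_def by auto
    ultimately show ?thesis by blast
  qed
  moreover have "e1 = e2" if "e1 \<in> N" "e2 \<in> N" "x \<in> e1" "x \<in> e2" for e1 e2 x
    using matching_disjoint[OF M(1)] that unfolding N_def by blast
  ultimately show "is_matching (W - {l, u}) E N" by (rule matchingI)
  have "\<exists>e. M \<subseteq> insert e N"
  proof (cases "\<exists>e\<in>M. u \<in> e")
    case True
    then obtain e where e: "e \<in> M" "u \<in> e" by blast
    have "e' = e" if "e' \<in> M" "u \<in> e'" for e'
      using matching_disjoint[OF M(1)] e that by blast
    then have "M \<subseteq> insert e N" unfolding N_def by blast
    then show ?thesis ..
  qed (auto simp: N_def)
  then obtain e where "M \<subseteq> insert e N" ..
  moreover have fN: "finite N" using M(2) by (simp add: N_def)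
  ultimately have "card M \<le> card (insert e N)" by (simp add: card_mono)
  also have "\<dots> \<le> Suc (card N)" using fN by (simp add: card_insert_if)
  finally show "card M \<le> Suc (card N)" .
qed

text \<open>By extension and restriction, the matching numbers of the two sets differ by exactly
  one. So dropping the edge at \<open>u\<close> and adding \<open>{l, u}\<close> both preserve
  maximality, and the added edge does not cover \<open>v\<close>.\<close>

lemma saturated_remove_iff:
  assumes "v \<noteq> l" "v \<noteq> u"
  shows "saturated (W - {l, u}) E v \<longleftrightarrow> saturated W E v"
proof
  assume sat: "saturated (W - {l, u}) E v"
  show "saturated W E v"
    unfolding saturated_def
  proof (intro allI impI)
    fix M assume max: "is_max_matching W E M"
    then have M: "is_matching W E M" "finite M" unfolding is_max_matching_def by auto
    let ?N = "{e \<in> M. u \<notin> e}"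
    note N = matching_restrict[OF M]
    have "card M' \<le> card ?N" if M': "is_matching (W - {l, u}) E M'" "finite M'" for M'
    proof -
      have "card (insert {l, u} M') \<le> card M"
        using max matching_extend[OF M'(1)] M'(2) unfolding is_max_matching_def by blast
      then show ?thesis using N(2) matching_extend(2)[OF M'(1)] M'(2) by simp
    qed
    then have "is_max_matching (W - {l, u}) E ?N"
      using N(1) M(2) unfolding is_max_matching_def by simp
    then show "\<exists>e\<in>M. v \<in> e" using sat unfolding saturated_def by blast
  qed
next
  assume sat: "saturated W E v"
  show "saturated (W - {l, u}) E v"
    unfolding saturated_def
  proof (intro allI impI)
    fix M assume max: "is_max_matching (W - {l, u}) E M"
    then have M: "is_matching (W - {l, u}) E M" "finite M" unfolding is_max_matching_def by auto
    note ext = matching_extend[OF M(1)]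
    have "card M' \<le> card (insert {l, u} M)" if M': "is_matching W E M'" "finite M'" for M'
    proof -
      have "card {e \<in> M'. u \<notin> e} \<le> card M"
        using max matching_restrict(1)[OF M'] M'(2) unfolding is_max_matching_def by simp
      then show ?thesis using matching_restrict(2)[OF M'] ext(2) M(2) by simp
    qed
    then have "is_max_matching W E (insert {l, u} M)"
      using ext(1) M(2) unfolding is_max_matching_def by simp
    then obtain e where "e \<in> insert {l, u} M" "v \<in> e" using sat unfolding saturated_def by blast
    then show "\<exists>e\<in>M. v \<in> e" using assms by blast
  qed
qed

text \<open>The coordinate at \<open>u\<close> must vanish because of row \<open>l\<close>; the coordinate at \<open>l\<close> is free to
  correct row \<open>u\<close>.\<close>
lemma extend_solution:
  fixes S :: "'a \<Rightarrow> 'a \<Rightarrow> 'b :: field"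
  assumes fin: "finite W" and S: "\<And>a b. a \<in> W \<Longrightarrow> b \<in> W \<Longrightarrow> S a b \<noteq> 0 \<longleftrightarrow> E a b"
    and x: "\<And>a. a \<in> W - {l, u} \<Longrightarrow> (\<Sum>b\<in>W - {l, u}. S a b * x b) = f a"
    and f: "f l = 0" "f u = 0"
  shows "\<exists>x'. (\<forall>a\<in>W. (\<Sum>b\<in>W. S a b * x' b) = f a) \<and> (\<forall>a\<in>W - {l, u}. x' a = x a)"
proof -
  define x' where "x' = x(u := 0, l := - (\<Sum>b\<in>W - {l, u}. S u b * x b) / S u l)"
  have lu: "E l u" using leaf u by blast
  then have Sul: "S u l \<noteq> 0" using S sym l u by blast
  have Sl: "S l b = 0" if "b \<in> W - {u}" for b using that S l leaf by blast
  have Sl': "S b l = 0" if "b \<in> W - {u}" for b using that S l leaf sym by blast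
  have split: "(\<Sum>b\<in>W. S a b * x' b) = S a l * x' l + (\<Sum>b\<in>W - {l, u}. S a b * x b)" for a
  proof -
    have W: "W = insert l (insert u (W - {l, u}))" using l u by blast
    have "(\<Sum>b\<in>W. S a b * x' b) = S a l * x' l + (S a u * x' u + (\<Sum>b\<in>W - {l, u}. S a b * x' b))"
      by (subst W) (use fin neq in simp)
    also have "(\<Sum>b\<in>W - {l, u}. S a b * x' b) = (\<Sum>b\<in>W - {l, u}. S a b * x b)"
      by (rule sum.cong) (auto simp: x'_def)
    finally show ?thesis using neq by (simp add: x'_def)
  qed
  have "(\<Sum>b\<in>W. S a b * x' b) = f a" if a: "a \<in> W" for a
  proof -
    consider "a = l" | "a = u" | "a \<in> W - {l, u}" using a by blast
    then show ?thesis
    proof cases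
      case 1
      have "(\<Sum>b\<in>W - {l, u}. S l b * x b) = 0" by (rule sum.neutral) (use Sl in auto)
      with 1 split[of l] Sl[of l] l neq f show ?thesis by simp
    next
      case 2
      with split[of u] Sul f show ?thesis by (simp add: x'_def)
    next
      case 3
      with split[of a] Sl'[of a] x[OF 3] show ?thesis by simp
    qed
  qed
  moreover have "\<forall>a\<in>W - {l, u}. x' a = x a" by (auto simp: x'_def)
  ultimately show ?thesis by blast
qed

end

text \<open>Induction by deleting a deepest non-isolated vertex together with its only neighbour.\<close>
lemma forest_saturated_solution:
  fixes S :: "'a \<Rightarrow> 'a \<Rightarrow> 'b :: field" and d :: "'a \<Rightarrow> nat"
  assumes "finite W" "v \<in> W"
    and sym: "\<And>a b. E a b \<Longrightarrow> E b a"
    and S: "\<And>a b. a \<in> W \<Longrightarrow> b \<in> W \<Longrightarrow> S a b \<noteq> 0 \<longleftrightarrow> E a b"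
    and d_neq: "\<And>a b. E a b \<Longrightarrow> d a \<noteq> d b"
    and parent: "\<And>a b c. E a b \<Longrightarrow> E a c \<Longrightarrow> d b \<le> d a \<Longrightarrow> d c \<le> d a \<Longrightarrow> b = c"
    and root: "\<And>a. a \<in> W \<Longrightarrow> d v \<le> d a"
  shows "if saturated W E v then \<exists>x. \<forall>a\<in>W. (\<Sum>b\<in>W. S a b * x b) = (if a = v then 1 else 0)
    else \<exists>x. x v = 1 \<and> (\<forall>a\<in>W. (\<Sum>b\<in>W. S a b * x b) = 0)"
  using assms(1,2) S root
proof (induction W rule: finite_psubset_induct)
  case (psubset W)
  note S = psubset.prems(2)
  show ?case
  proof (cases "\<exists>a\<in>W. \<exists>b\<in>W. E a b")
    case False
    then have "\<not> saturated W E v" by (intro not_saturated_no_edges) blast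
    \<comment> \<open>Without edges \<open>S\<close> vanishes on \<open>W\<close>, so the unit
      vector at \<open>v\<close> is a kernel vector.\<close>
    moreover have "(\<Sum>b\<in>W. S a b * (if b = v then 1 else 0)) = 0" if "a \<in> W" for a
    proof (rule sum.neutral, rule ballI)
      fix b assume "b \<in> W"
      with False S[OF that this] that have "S a b = 0" by blast
      then show "S a b * (if b = v then 1 else 0) = 0" by simp
    qed
    ultimately show ?thesis by (auto intro!: exI[of _ "\<lambda>b. if b = v then 1 else 0"])
  next
    case True
    let ?N = "{a \<in> W. \<exists>b\<in>W. E a b}"
    have "finite ?N" "?N \<noteq> {}" using psubset.hyps True by auto
    then have "Max (d ` ?N) \<in> d ` ?N" by (intro Max_in) auto
    then obtain l where ml: "Max (d ` ?N) = d l" and l: "l \<in> ?N" by (rule imageE)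
    have max: "d a \<le> d l" if "a \<in> ?N" for a
      using that \<open>finite ?N\<close> unfolding ml[symmetric] by (intro Max_ge) auto
    from l obtain u where u: "u \<in> W" "E l u" by blast
    \<comment> \<open>No neighbour of \<open>l\<close> is deeper than \<open>l\<close>, and by
      \<open>parent\<close> a vertex has at most one neighbour that is not deeper. So
      \<open>l\<close> is a leaf within \<open>W\<close>.\<close>
    have deg: "E l w \<longleftrightarrow> w = u" if "w \<in> W" for w
    proof
      assume "E l w"
      moreover have "d w \<le> d l" "d u \<le> d l"
        using max u l that sym \<open>E l w\<close> by blast+
      ultimately show "w = u" using parent[OF _ u(2)] by blast
    qed (use u in blast)
    \<comment> \<open>Since \<open>u\<close> lies strictly above \<open>l\<close> and the root has
      least depth, \<open>l\<close> is not the root.\<close>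
    have "d u \<noteq> d l" "d u \<le> d l" using d_neq[OF u(2)] max[of u] u l sym by auto
    moreover have "d v \<le> d u" using psubset.prems(3) u by blast
    ultimately have lv: "l \<noteq> v" and lu: "l \<noteq> u" by auto
    interpret pendant W E l u
      using l u deg lu sym by unfold_locales auto
    show ?thesis
    proof (cases "u = v")
      case True
      \<comment> \<open>Column \<open>l\<close> has its only nonzero entry in row \<open>u\<close>,
        which is the root here, so a multiple of this column is the unit vector at
        \<open>v\<close>.\<close>
      have "(\<Sum>b\<in>W. S a b * (if b = l then 1 / S v l else 0)) = (if a = v then 1 else 0)" if "a \<in> W" for a
      proof -
        have "(\<Sum>b\<in>W. S a b * (if b = l then 1 / S v l else 0)) = S a l / S v l"
          using psubset.hyps l by (simp add: if_distrib[of "\<lambda>x. _ * x"] sum.delta cong: if_cong)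
        moreover have "S a l \<noteq> 0 \<longleftrightarrow> a = u" using S l deg sym that by blast
        ultimately show ?thesis using True by auto
      qed
      then have "\<forall>a\<in>W. (\<Sum>b\<in>W. S a b * (if b = l then 1 / S v l else 0)) = (if a = v then 1 else 0)"
        by blast
      then have "\<exists>x. \<forall>a\<in>W. (\<Sum>b\<in>W. S a b * x b) = (if a = v then 1 else 0)"
        by (rule exI[of _ "\<lambda>b. if b = l then 1 / S v l else 0"])
      moreover have "saturated W E v" using saturated_neighbour True by simp
      ultimately show ?thesis by (simp only: if_True)
    next
      case False
      have sub: "W - {l, u} \<subset> W" using l by blast
      have v: "v \<in> W - {l, u}" using psubset.prems(1) False lv by blast
      have sat: "saturated (W - {l, u}) E v = saturated W E v"
        using saturated_remove_iff[of v] lv False by blast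
      have IH: "if saturated W E v
        then \<exists>x. \<forall>a\<in>W - {l, u}. (\<Sum>b\<in>W - {l, u}. S a b * x b) = (if a = v then 1 else 0)
        else \<exists>x. x v = 1 \<and> (\<forall>a\<in>W - {l, u}. (\<Sum>b\<in>W - {l, u}. S a b * x b) = 0)"
        using psubset.IH[OF sub v] psubset.prems(3) S unfolding sat by blast
      show ?thesis
      proof (cases "saturated W E v")
        case True
        with IH obtain x where "\<And>a. a \<in> W - {l, u} \<Longrightarrow> (\<Sum>b\<in>W - {l, u}. S a b * x b) = (if a = v then 1 else 0)"
          by auto
        from extend_solution[OF psubset.hyps S this] lv False obtain x'
          where "\<forall>a\<in>W. (\<Sum>b\<in>W. S a b * x' b) = (if a = v then 1 else 0)" by (auto simp only: if_False)
        then have "\<exists>x. \<forall>a\<in>W. (\<Sum>b\<in>W. S a b * x b) = (if a = v then 1 else 0)"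
          by (rule exI[of _ x'])
        with True show ?thesis by (simp only: if_True)
      next
        case unsat: False
        with IH obtain x where x: "x v = 1"
          "\<And>a. a \<in> W - {l, u} \<Longrightarrow> (\<Sum>b\<in>W - {l, u}. S a b * x b) = 0"
          by auto
        from extend_solution[OF psubset.hyps S, of x "\<lambda>_. 0"] x(2)
        obtain x' where "\<forall>a\<in>W. (\<Sum>b\<in>W. S a b * x' b) = 0" "\<forall>a\<in>W - {l, u}. x' a = x a" by auto
        with x(1) v have "\<exists>x. x v = 1 \<and> (\<forall>a\<in>W. (\<Sum>b\<in>W. S a b * x b) = 0)"
          by (intro exI[of _ x']) auto
        with unsat show ?thesis by (simp only: if_False)
      qed
    qed
  qed
qed

subsection \<open>Structure of unicyclic graphs\<close>

lemma cycle_edges_image: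
  "cycle_edges cs = (\<lambda>i. {cs ! i, cs ! ((i + 1) mod length cs)}) ` {..<length cs}"
  unfolding cycle_edges_def by auto

lemma cycle_edge_subset:
  assumes "e \<in> cycle_edges cs"
  shows "e \<subseteq> set cs"
proof -
  obtain i where i: "i < length cs" "e = {cs ! i, cs ! ((i + 1) mod length cs)}"
    using assms unfolding cycle_edges_def by blast
  then have "length cs > 0" by linarith
  then have "(i + 1) mod length cs < length cs" by (rule mod_less_divisor)
  with i show ?thesis by simp
qed

text \<open>If two different indices gave the same edge, each would be the cyclic successor of the
  other. The length would then divide 2, but it is at least 3.\<close>

lemma card_cycle_edges:
  assumes "is_cycle Arc cs"
  shows "card (cycle_edges cs) = length cs"
proof -
  let ?n = "length cs"
  have n: "?n \<ge> 3" and dist: "distinct cs" using assms unfolding is_cycle_def by auto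
  have "inj_on (\<lambda>i. {cs ! i, cs ! ((i + 1) mod ?n)}) {..<?n}"
  proof (rule inj_onI, rule ccontr)
    fix i j assume ij: "i \<in> {..<?n}" "j \<in> {..<?n}" "i \<noteq> j"
      and eq: "{cs ! i, cs ! ((i + 1) mod ?n)} = {cs ! j, cs ! ((j + 1) mod ?n)}"
    have lt: "(i + 1) mod ?n < ?n" "(j + 1) mod ?n < ?n" using n by (auto intro!: mod_less_divisor)
    have "cs ! i \<noteq> cs ! j" using ij dist by (simp add: nth_eq_iff_index_eq)
    then have "cs ! i = cs ! ((j + 1) mod ?n)" "cs ! j = cs ! ((i + 1) mod ?n)"
      using eq by (metis doubleton_eq_iff)+
    then have "i = (j + 1) mod ?n" "j = (i + 1) mod ?n"
      using ij lt dist by (simp_all add: nth_eq_iff_index_eq)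
    moreover have "(k + 1) mod ?n = (if k + 1 = ?n then 0 else k + 1)" if "k < ?n" for k
      using that by auto
    ultimately have "i = (if j + 1 = ?n then 0 else j + 1)" "j = (if i + 1 = ?n then 0 else i + 1)"
      using ij(1,2) by (metis lessThan_iff)+
    note step = this
    show False
    proof (cases "j + 1 = ?n")
      case True
      with step(1) have "i = 0" by simp
      with step(2) n have "j = 1" by simp
      with True n show False by simp
    next
      case False
      with step(1) have i: "i = j + 1" by (simp only: if_False)
      show False
      proof (cases "i + 1 = ?n")
        case True
        with step(2) have "j = 0" by simp
        with True i n show False by simp
      next
        case False
        with step(2) have "j = i + 1" by (simp only: if_False)
        with i show False by simp
      qed
    qed
  qed
  then show ?thesis unfolding cycle_edges_image by (simp add: card_image)
qed

lemma cycle_edges_subset_edges: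
  assumes "is_cycle Arc cs"
  shows "cycle_edges cs \<subseteq> edges Arc"
  using assms unfolding is_cycle_def cycle_edges_def edges_def by blast

section \<open>Parents and depths off the cycle\<close>

lemma adj_sym: "adj Arc u v \<Longrightarrow> adj Arc v u"
  by (auto simp: adj_def)

lemma finite_edges:
  assumes "oriented_graph V Arc"
  shows "finite (edges Arc)"
proof (rule finite_subset)
  show "edges Arc \<subseteq> Pow V"
    using assms unfolding oriented_graph_def edges_def adj_def by blast
  show "finite (Pow V)" using assms by (simp add: oriented_graph_def)
qed

text \<open>Take for \<open>d\<close> the distance from \<open>C\<close>, and for \<open>p u\<close>
  the last vertex before \<open>u\<close> on a shortest walk from \<open>C\<close>.\<close>

lemma exists_nearer_neighbour:
  assumes conn: "\<And>u. u \<in> V \<Longrightarrow> \<exists>c\<in>C. E\<^sup>*\<^sup>* c u" and sym: "\<And>u w. E u w \<Longrightarrow> E w u"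
  shows "\<exists>d p. \<forall>u\<in>V - C. E u (p u) \<and> d (p u) < (d u :: nat)"
proof -
  define R where "R u n \<longleftrightarrow> (\<exists>c\<in>C. (E ^^ n) c u)" for u n
  define d where "d u = (LEAST n. R u n)" for u
  have "\<exists>w. E u w \<and> d w < d u" if u: "u \<in> V - C" for u
  proof -
    have "\<exists>n. R u n" using conn[of u] u unfolding R_def by (auto simp: rtranclp_is_Sup_relpowp)
    then have R: "R u (d u)" unfolding d_def by (rule LeastI_ex)
    have "d u \<noteq> 0" using R u unfolding R_def by (metis DiffD2 relpowp_0_E)
    then obtain n where n: "d u = Suc n" using not0_implies_Suc by blast
    with R obtain c w where "c \<in> C" "(E ^^ n) c w" "E w u" unfolding R_def by (metis relpowp_Suc_E)
    then have "E u w" "d w \<le> n" using sym unfolding d_def R_def by (auto intro!: Least_le)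
    with n show ?thesis by auto
  qed
  then show ?thesis by metis
qed

text \<open>Each vertex off the cycle contributes the edge to a neighbour nearer to the cycle. Together
  with the cycle edges these are already \<open>card V\<close> many, so there are no further edges.\<close>
lemma unicyclic_parent:
  assumes G: "oriented_graph V Arc" and U: "unicyclic V Arc" and cyc: "is_cycle Arc cs"
  obtains d :: "'a \<Rightarrow> nat" and p :: "'a \<Rightarrow> 'a"
  where "set cs \<subseteq> V" "\<forall>u\<in>V - set cs. d (p u) < d u"
    and "\<forall>u w. adj_minus_cycle Arc cs u w \<longleftrightarrow>
      (u \<in> V - set cs \<and> w = p u) \<or> (w \<in> V - set cs \<and> u = p w)"
proof -
  let ?C = "set cs" and ?n = "length cs"
  have finV: "finite V" and inV: "\<And>u w. adj Arc u w \<Longrightarrow> u \<in> V \<and> w \<in> V"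
    using G unfolding oriented_graph_def adj_def by auto
  have n: "?n \<ge> 3" "distinct cs" and cadj: "\<And>i. i < ?n \<Longrightarrow> adj Arc (cs ! i) (cs ! ((i + 1) mod ?n))"
    using cyc unfolding is_cycle_def by auto
  have CV: "?C \<subseteq> V"
  proof
    fix c assume "c \<in> ?C"
    then obtain i where "i < ?n" "c = cs ! i" by (auto simp: in_set_conv_nth)
    then show "c \<in> V" using cadj inV by blast
  qed
  have reach: "\<exists>c\<in>?C. (adj Arc)\<^sup>*\<^sup>* c u" if "u \<in> V" for u
  proof
    show c0: "cs ! 0 \<in> ?C" using n(1) by (intro nth_mem) linarith
    show "(adj Arc)\<^sup>*\<^sup>* (cs ! 0) u"
      using U subsetD[OF CV c0] that unfolding unicyclic_def connected_graph_def by simp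
  qed
  have "\<exists>(d :: 'a \<Rightarrow> nat) p. \<forall>u\<in>V - ?C. adj Arc u (p u) \<and> d (p u) < d u"
    by (rule exists_nearer_neighbour[OF reach adj_sym])
  then obtain d :: "'a \<Rightarrow> nat" where "\<exists>p. \<forall>u\<in>V - ?C. adj Arc u (p u) \<and> d (p u) < d u" ..
  then obtain p where pd: "\<forall>u\<in>V - ?C. adj Arc u (p u) \<and> d (p u) < d u" ..
  then have p: "adj Arc u (p u)" and d: "d (p u) < d u" if "u \<in> V - ?C" for u
    using that by simp_all
  let ?P = "(\<lambda>u. {u, p u}) ` (V - ?C)"
  \<comment> \<open>Two vertices with the same parent edge would be parents of each other, and
    \<open>d\<close> would decrease in both directions.\<close>
  have "inj_on (\<lambda>u. {u, p u}) (V - ?C)"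
  proof (rule inj_onI, rule ccontr)
    fix u w assume *: "u \<in> V - ?C" "w \<in> V - ?C" "{u, p u} = {w, p w}" "u \<noteq> w"
    then have "u = p w" "w = p u" by (auto simp: doubleton_eq_iff)
    then have "d u < d w" "d w < d u" using d[OF *(1)] d[OF *(2)] by simp_all
    then show False by simp
  qed
  then have "card ?P = card (V - ?C)" by (rule card_image)
  \<comment> \<open>A parent edge contains a vertex off the cycle, a cycle edge does not.\<close>
  moreover have disj: "cycle_edges cs \<inter> ?P = {}" using cycle_edge_subset by fastforce
  moreover have "finite (cycle_edges cs)" unfolding cycle_edges_image by simp
  ultimately have "card (cycle_edges cs \<union> ?P) = ?n + card (V - ?C)"
    using finV card_cycle_edges[OF cyc] by (simp add: card_Un_disjoint)
  also have "\<dots> = card V"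
    using CV finV distinct_card[OF n(2)] card_mono[OF finV CV] by (simp add: card_Diff_subset)
  also have "\<dots> = card (edges Arc)" using U unfolding unicyclic_def by simp
  finally have card: "card (cycle_edges cs \<union> ?P) = card (edges Arc)" .
  have "?P \<subseteq> edges Arc" using p unfolding edges_def by blast
  with cycle_edges_subset_edges[OF cyc] have "cycle_edges cs \<union> ?P \<subseteq> edges Arc" by blast
  with card have all: "cycle_edges cs \<union> ?P = edges Arc"
    by (intro card_subset_eq finite_edges[OF G])
  have "adj_minus_cycle Arc cs u w \<longleftrightarrow>
      (u \<in> V - set cs \<and> w = p u) \<or> (w \<in> V - set cs \<and> u = p w)" for u w
  proof
    assume "adj_minus_cycle Arc cs u w"
    then have "{u, w} \<in> edges Arc" "{u, w} \<notin> cycle_edges cs"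
      unfolding adj_minus_cycle_def edges_def by auto
    with all have "{u, w} \<in> ?P" by blast
    then show "(u \<in> V - set cs \<and> w = p u) \<or> (w \<in> V - set cs \<and> u = p w)"
      by (auto simp: doubleton_eq_iff)
  next
    assume *: "(u \<in> V - set cs \<and> w = p u) \<or> (w \<in> V - set cs \<and> u = p w)"
    then have "{u, w} \<in> ?P" by (auto simp: insert_commute)
    with disj have "{u, w} \<notin> cycle_edges cs" by blast
    moreover have "adj Arc u w" using * p[of u] adj_sym[OF p, of w] by blast
    ultimately show "adj_minus_cycle Arc cs u w" by (simp add: adj_minus_cycle_def)
  qed
  with CV pd show ?thesis by (intro that[of d p]) simp_all
qed

text \<open>Following parents from \<open>u\<close> ends at the cycle vertex \<open>r u\<close>, the
  root of the tree containing \<open>u\<close>. The last two conclusions give the forest hypotheses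
  of \<open>forest_saturated_solution\<close>, with \<open>d\<close> as depth.\<close>

lemma unicyclic_tree_structure:
  assumes G: "oriented_graph V Arc" and U: "unicyclic V Arc" and cyc: "is_cycle Arc cs"
  obtains r :: "'a \<Rightarrow> 'a" and d :: "'a \<Rightarrow> nat"
  where "set cs \<subseteq> V" "\<forall>u\<in>V. r u \<in> set cs" "\<forall>c\<in>set cs. r c = c" "\<forall>c\<in>set cs. d c = 0"
    and "\<forall>u w. adj_minus_cycle Arc cs u w \<longrightarrow> r u = r w"
    and "\<forall>c\<in>set cs. rooted_tree Arc cs c = {u \<in> V. r u = c}"
    and "\<forall>u w. adj_minus_cycle Arc cs u w \<longrightarrow> d u \<noteq> d w"
    and "\<forall>u w w'. adj_minus_cycle Arc cs u w \<longrightarrow> adj_minus_cycle Arc cs u w' \<longrightarrow>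
      d w \<le> d u \<longrightarrow> d w' \<le> d u \<longrightarrow> w = w'"
proof -
  let ?C = "set cs" and ?E = "adj_minus_cycle Arc cs"
  obtain d0 :: "'a \<Rightarrow> nat" and p :: "'a \<Rightarrow> 'a" where CV: "?C \<subseteq> V" and d0: "\<forall>u\<in>V - ?C. d0 (p u) < d0 u"
    and E': "\<forall>u w. ?E u w \<longleftrightarrow> (u \<in> V - ?C \<and> w = p u) \<or> (w \<in> V - ?C \<and> u = p w)"
    by (rule unicyclic_parent[OF G U cyc])
  have E: "?E u w \<longleftrightarrow> (u \<in> V - ?C \<and> w = p u) \<or> (w \<in> V - ?C \<and> u = p w)" for u w
    using E' by blast
  have inV: "u \<in> V \<and> w \<in> V" if "?E u w" for u w
    using that G unfolding adj_minus_cycle_def adj_def oriented_graph_def by blast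
  \<comment> \<open>Nothing is known about \<open>d0\<close> on the cycle itself. Value 0 there and
    the shift by \<open>Suc\<close> elsewhere make every parent strictly less deep, also when it
    lies on the cycle.\<close>
  define d where "d u = (if u \<in> ?C then 0 else Suc (d0 u))" for u
  have d: "d (p u) < d u" if "u \<in> V - ?C" for u using d0 that by (auto simp: d_def)
  have dp: "w = p u" if "?E u w" "d w \<le> d u" for u w
    using that d E by (metis leD)
  \<comment> \<open>\<open>q\<close> moves to the parent but fixes cycle vertices. Surplus
    iterations are therefore harmless, and one number \<open>N\<close> of iterations, bounding all
    depths, serves every vertex.\<close>
  define q where "q u = (if u \<in> ?C then u else p u)" for u
  define N where "N = Max (d ` V)"
  have finV: "finite V" using G by (simp add: oriented_graph_def)
  have N: "d u \<le> N" if "u \<in> V" for u using that finV by (simp add: N_def)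
  define r where "r u = (q ^^ N) u" for u
  have qC: "(q ^^ n) c = c" if "c \<in> ?C" for c n using that by (induction n) (auto simp: q_def)
  have it: "(q ^^ n) u \<in> ?C \<and> ?E\<^sup>*\<^sup>* ((q ^^ n) u) u" if "u \<in> V" "d u \<le> n" for u n
    using that
  proof (induction n arbitrary: u)
    case 0
    then show ?case by (auto simp: d_def split: if_splits)
  next
    case (Suc n)
    show ?case
    proof (cases "u \<in> ?C")
      case True
      then show ?thesis using qC[OF True, of "Suc n"] by simp
    next
      case False
      then have u: "u \<in> V - ?C" using Suc.prems by simp
      have e: "?E (p u) u" using u E by blast
      have "(q ^^ n) (p u) \<in> ?C \<and> ?E\<^sup>*\<^sup>* ((q ^^ n) (p u)) (p u)"
        using Suc.IH[of "p u"] inV[OF e] d[OF u] Suc.prems by simp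
      moreover have "(q ^^ Suc n) u = (q ^^ n) (p u)"
        using False by (simp add: funpow_Suc_right q_def del: funpow.simps)
      ultimately show ?thesis using e by (auto intro: rtranclp.rtrancl_into_rtrancl)
    qed
  qed
  have rC: "r u \<in> ?C" and reach: "?E\<^sup>*\<^sup>* (r u) u" if "u \<in> V" for u
    using it[OF that N[OF that]] by (auto simp: r_def)
  \<comment> \<open>\<open>r\<close> is an iterate of \<open>q\<close>, so the two commute, and
    \<open>q\<close> fixes the cycle vertex \<open>r u\<close>.\<close>
  have rp: "r (p u) = r u" if u: "u \<in> V - ?C" for u
  proof -
    have "r (p u) = (q ^^ N) (q u)" using u by (simp add: r_def q_def)
    also have "\<dots> = q (r u)" by (simp add: r_def funpow_swap1)
    also have "\<dots> = r u" using rC[of u] u by (simp add: q_def)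
    finally show ?thesis .
  qed
  have rE: "r u = r w" if "?E u w" for u w using that E rp by metis
  have tree: "rooted_tree Arc cs c = {u \<in> V. r u = c}" if c: "c \<in> ?C" for c
  proof -
    have "u \<in> V \<and> r u = c" if "?E\<^sup>*\<^sup>* c u" for u
      using that
    proof (induction rule: rtranclp_induct)
      case base
      then show ?case using c CV qC[OF c] by (auto simp: r_def)
    next
      case (step y z)
      then show ?case using rE inV by metis
    qed
    then show ?thesis unfolding rooted_tree_def using reach by blast
  qed
  show ?thesis
  proof (rule that[of r d])
    show "?C \<subseteq> V" by (rule CV)
    show "\<forall>u\<in>V. r u \<in> ?C" using rC by blast
    show "\<forall>c\<in>?C. r c = c" using qC by (simp add: r_def)
    show "\<forall>c\<in>?C. d c = 0" by (simp add: d_def)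
    show "\<forall>u w. ?E u w \<longrightarrow> r u = r w" using rE by blast
    show "\<forall>c\<in>?C. rooted_tree Arc cs c = {u \<in> V. r u = c}" using tree by blast
    show "\<forall>u w. ?E u w \<longrightarrow> d u \<noteq> d w" using E d by (metis less_irrefl)
    show "\<forall>u w w'. ?E u w \<longrightarrow> ?E u w' \<longrightarrow> d w \<le> d u \<longrightarrow> d w' \<le> d u \<longrightarrow> w = w'"
      using dp by metis
  qed
qed

subsection \<open>The rank formula\<close>

text \<open>Exchanging the two summation indices shows that the form equals its own
  negative.\<close>

lemma skew_form_zero:
  fixes S :: "'a \<Rightarrow> 'a \<Rightarrow> real"
  assumes "\<And>a b. S a b = - S b a"
  shows "(\<Sum>a\<in>T. x a * (\<Sum>b\<in>T. S a b * x b)) = 0"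
proof -
  let ?q = "\<Sum>a\<in>T. \<Sum>b\<in>T. x a * S a b * x b"
  have "?q = (\<Sum>b\<in>T. \<Sum>a\<in>T. x a * S a b * x b)" by (rule sum.swap)
  also have "\<dots> = (\<Sum>b\<in>T. \<Sum>a\<in>T. - (x b * S b a * x a))"
  proof (intro sum.cong refl)
    fix a b
    show "x a * S a b * x b = - (x b * S b a * x a)"
      using assms[of a b] by simp
  qed
  also have "\<dots> = - ?q" by (simp add: sum_negf)
  finally have "?q = 0" by simp
  then show ?thesis by (simp add: sum_distrib_left mult.assoc)
qed

lemma skew_entry_nonzero_iff: "skew_entry Arc u v \<noteq> 0 \<longleftrightarrow> adj Arc u v"
  by (simp add: skew_entry_def adj_def)

theorem theorem4p5:
  fixes V :: "'a::linorder set" and Arc :: "'a \<Rightarrow> 'a \<Rightarrow> bool" and cs :: "'a list"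
  assumes "oriented_graph V Arc"
    and "unicyclic V Arc"
    and "is_cycle Arc cs"
  shows "(\<forall>v. v \<in> set cs \<and>
             saturated (rooted_tree Arc cs v) (adj_minus_cycle Arc cs) v \<longrightarrow>
             skew_rank Arc V = skew_rank Arc (rooted_tree Arc cs v)
                              + skew_rank Arc (V - rooted_tree Arc cs v))
       \<and> ((\<forall>v\<in>set cs. \<not> saturated (rooted_tree Arc cs v) (adj_minus_cycle Arc cs) v) \<longrightarrow>
             skew_rank Arc V = skew_rank Arc (set cs) + skew_rank Arc (V - set cs))"
proof -
  let ?C = "set cs" and ?E = "adj_minus_cycle Arc cs" and ?S = "skew_entry Arc"
  obtain r :: "'a \<Rightarrow> 'a" and d :: "'a \<Rightarrow> nat" where CV: "?C \<subseteq> V"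
    and r: "\<forall>u\<in>V. r u \<in> ?C" "\<forall>c\<in>?C. r c = c" and d0: "\<forall>c\<in>?C. d c = 0"
    and rE: "\<forall>u w. ?E u w \<longrightarrow> r u = r w"
    and tree: "\<forall>c\<in>?C. rooted_tree Arc cs c = {u \<in> V. r u = c}"
    and dE: "\<forall>u w. ?E u w \<longrightarrow> d u \<noteq> d w"
    and parent: "\<forall>u w w'. ?E u w \<longrightarrow> ?E u w' \<longrightarrow> d w \<le> d u \<longrightarrow> d w' \<le> d u \<longrightarrow> w = w'"
    by (rule unicyclic_tree_structure[OF assms])
  define T where "T c = {u \<in> V. r u = c}" for c
  have finV: "finite V" and irrefl: "\<And>u. \<not> adj Arc u u" and asym: "\<And>u v. Arc u v \<Longrightarrow> \<not> Arc v u"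
    using assms(1) unfolding oriented_graph_def adj_def by blast+
  have finT: "finite (T c)" for c using finV by (simp add: T_def)
  have skew: "?S a b = - ?S b a" for a b using asym by (auto simp: skew_entry_def)
  have cycle_adj: "a \<in> ?C \<and> b \<in> ?C" if "adj Arc a b" "\<not> ?E a b" for a b
    using that cycle_edge_subset[of "{a, b}" cs] unfolding adj_minus_cycle_def by simp
  \<comment> \<open>Edges outside the cycle stay within one tree, so different trees are linked only
    by edges between cycle vertices.\<close>
  have cross: "?S a b = 0" if "r a \<noteq> r b" "a \<notin> ?C \<or> b \<notin> ?C" for a b
    using that cycle_adj[of a b] rE skew_entry_nonzero_iff[of Arc a b] by blast
  \<comment> \<open>The subgraph induced on a tree has no further edges: such an edge would be a
    cycle edge, but \<open>c\<close> is the only cycle vertex in \<open>T c\<close>.\<close>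
  have TE: "?S a b \<noteq> 0 \<longleftrightarrow> ?E a b" if "a \<in> T c" "b \<in> T c" for a b c
  proof
    assume "?S a b \<noteq> 0"
    then have ab: "adj Arc a b" by (simp add: skew_entry_nonzero_iff)
    show "?E a b"
    proof (rule ccontr)
      assume "\<not> ?E a b"
      with ab cycle_adj have "a \<in> ?C" "b \<in> ?C" by blast+
      then have "a = b" using r(2) that by (simp add: T_def)
      with ab irrefl show False by blast
    qed
  qed (simp add: skew_entry_nonzero_iff adj_minus_cycle_def)
  have solution: "if saturated (T c) ?E c
      then \<exists>x. \<forall>a\<in>T c. (\<Sum>b\<in>T c. ?S a b * x b) = (if a = c then 1 else 0)
      else \<exists>x. x c = 1 \<and> (\<forall>a\<in>T c. (\<Sum>b\<in>T c. ?S a b * x b) = 0)" if c: "c \<in> ?C" for c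
  proof (rule forest_saturated_solution[where d = d])
    show "finite (T c)" by (rule finT)
    show "c \<in> T c" using c CV r(2) by (auto simp: T_def)
    show "?E b a" if "?E a b" for a b
      using that adj_sym[of Arc a b] by (simp add: adj_minus_cycle_def insert_commute)
    show "?S a b \<noteq> 0 \<longleftrightarrow> ?E a b" if "a \<in> T c" "b \<in> T c" for a b using TE[OF that] .
    show "d a \<noteq> d b" if "?E a b" for a b using dE that by blast
    show "b = b'" if "?E a b" "?E a b'" "d b \<le> d a" "d b' \<le> d a" for a b b'
      using parent that by blast
    show "d c \<le> d a" if "a \<in> T c" for a using d0 c by simp
  qed
  have part1: "skew_rank Arc V = skew_rank Arc (T v) + skew_rank Arc (V - T v)"
    if v: "v \<in> ?C" and sat: "saturated (T v) ?E v" for v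
  proof -
    obtain x where x: "\<forall>a\<in>T v. (\<Sum>b\<in>T v. ?S a b * x b) = (if a = v then 1 else 0)"
      using solution[OF v] sat by (simp only: if_True) blast
    have vT: "v \<in> T v" using v CV r(2) by (auto simp: T_def)
    have "(\<Sum>a\<in>T v. x a * (\<Sum>b\<in>T v. ?S a b * x b)) = (\<Sum>a\<in>T v. if a = v then x a else 0)"
      using x by (intro sum.cong) auto
    also have "\<dots> = x v" using vT finT by simp
    finally have xv: "x v = 0" using skew_form_zero[of ?S, OF skew] by simp
    \<comment> \<open>Only the root of \<open>T v\<close> has neighbours outside
      \<open>T v\<close>.\<close>
    have zero: "?S b a = 0" "?S a b = 0" if "b \<in> T v" "a \<in> V - T v" "b \<noteq> v" for a b
    proof -
      have "r b = v" "r a \<noteq> v" using that by (auto simp: T_def)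
      moreover have "b \<notin> ?C" using r(2) that \<open>r b = v\<close> by auto
      ultimately show "?S b a = 0" "?S a b = 0" by (auto intro: cross)
    qed
    have "skew_rank Arc ((V - T v) \<union> T v) = skew_rank Arc (V - T v) + skew_rank Arc (T v)"
    \<comment> \<open>The block from \<open>T v\<close> to the rest is zero outside row
      \<open>v\<close>. It is thus the unit vector at \<open>v\<close> times that row, and replacing
      the unit vector by its preimage \<open>x\<close> gives \<open>Z\<close>.\<close>
    proof (rule skew_rank_split[where Z = "\<lambda>b a. x b * ?S v a"])
      show "finite (V - T v)" "finite (T v)" "(V - T v) \<inter> T v = {}" using finV finT by auto
      show "\<not> Arc w u" if "Arc u w" for u w using asym[OF that] .
      show "?S b a = (\<Sum>b'\<in>T v. ?S b b' * (x b' * ?S v a))" if "b \<in> T v" "a \<in> V - T v" for b a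
      proof -
        have "(\<Sum>b'\<in>T v. ?S b b' * (x b' * ?S v a)) = (\<Sum>b'\<in>T v. ?S b b' * x b') * ?S v a"
          by (simp add: sum_distrib_right mult.assoc)
        then show ?thesis using x zero(1)[OF that] that(1) by auto
      qed
      \<comment> \<open>Terms with \<open>b \<noteq> v\<close> vanish by \<open>zero\<close>, the
        term of \<open>v\<close> because \<open>x v = 0\<close>.\<close>
      show "(\<Sum>b\<in>T v. ?S a b * (x b * ?S v a')) = 0" if "a \<in> V - T v" for a a'
        by (rule sum.neutral) (use zero(2) xv that in auto)
    qed
    moreover have "(V - T v) \<union> T v = V" by (auto simp: T_def)
    ultimately show ?thesis by simp
  qed
  have part2: "skew_rank Arc V = skew_rank Arc ?C + skew_rank Arc (V - ?C)"
    if unsat: "\<forall>v\<in>?C. \<not> saturated (T v) ?E v"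
  proof -
    have "\<forall>c\<in>?C. \<exists>x. x c = 1 \<and> (\<forall>a\<in>T c. (\<Sum>b\<in>T c. ?S a b * x b) = 0)"
      using solution unsat by (simp only: if_False) simp
    then obtain y where y: "\<forall>c\<in>?C. y c c = 1 \<and> (\<forall>a\<in>T c. (\<Sum>b\<in>T c. ?S a b * y c b) = 0)"
      by (rule bchoice[THEN exE])
    \<comment> \<open>As \<open>y c\<close> is a kernel vector on \<open>T c\<close> with value 1 at
      \<open>c\<close>, column \<open>c\<close> on the rows of \<open>T c\<close> is minus the
      combination of the other columns with weights \<open>y c\<close>.\<close>
    define Z where "Z b c = (if r b = c then - y c b else 0)" for b c
    \<comment> \<open>This serves both conditions of the splitting. Rows off the cycle give the
      column condition; for a row on the cycle, \<open>r a = c\<close> means \<open>a = c\<close>,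
      and the diagonal entry is 0.\<close>
    have sum_Z: "(\<Sum>b\<in>V - ?C. ?S a b * Z b c) = (if r a = c then ?S a c else 0)"
      if a: "a \<in> V" and c: "c \<in> ?C" for a c
    proof -
      have cT: "c \<in> T c" using c CV r(2) by (auto simp: T_def)
      have Tc: "T c - {c} = {b \<in> V - ?C. r b = c}" using c r(2) by (auto simp: T_def)
      have "(\<Sum>b\<in>V - ?C. ?S a b * Z b c) = (\<Sum>b\<in>V - ?C. if r b = c then - (?S a b * y c b) else 0)"
        by (intro sum.cong) (auto simp: Z_def)
      also have "\<dots> = (\<Sum>b\<in>T c - {c}. - (?S a b * y c b))"
        unfolding Tc using finV by (intro sum.inter_filter[symmetric]) simp
      also have "\<dots> = - (\<Sum>b\<in>T c - {c}. ?S a b * y c b)" by (simp add: sum_negf)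
      also have "\<dots> = (if r a = c then ?S a c else 0)"
      proof (cases "r a = c")
        case True
        then have "a \<in> T c" using a by (simp add: T_def)
        then have "0 = (\<Sum>b\<in>T c. ?S a b * y c b)" using y c by simp
        also have "\<dots> = ?S a c * y c c + (\<Sum>b\<in>T c - {c}. ?S a b * y c b)"
          using cT finT by (intro sum.remove)
        finally show ?thesis using True y c by simp
      next
        case False
        have "?S a b = 0" if "b \<in> T c - {c}" for b
          using that False unfolding Tc by (intro cross) auto
        then have "(\<Sum>b\<in>T c - {c}. ?S a b * y c b) = 0" by (intro sum.neutral) simp
        with False show ?thesis by simp
      qed
      finally show ?thesis .
    qed
    have "skew_rank Arc (?C \<union> (V - ?C)) = skew_rank Arc ?C + skew_rank Arc (V - ?C)"
    proof (rule skew_rank_split[where Z = Z])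
      show "finite ?C" "finite (V - ?C)" "?C \<inter> (V - ?C) = {}" using finV by auto
      show "\<not> Arc w u" if "Arc u w" for u w using asym[OF that] .
      show "?S b c = (\<Sum>b'\<in>V - ?C. ?S b b' * Z b' c)" if "b \<in> V - ?C" "c \<in> ?C" for b c
        using sum_Z[of b c] cross[of b c] r(2) that by auto
      show "(\<Sum>b\<in>V - ?C. ?S c b * Z b c') = 0" if "c \<in> ?C" "c' \<in> ?C" for c c'
        using sum_Z[of c c'] CV r(2) that irrefl skew_entry_nonzero_iff[of Arc c c] by auto
    qed
    moreover have "?C \<union> (V - ?C) = V" using CV by blast
    ultimately show ?thesis by simp
  qed
  have eq: "rooted_tree Arc cs c = T c" if "c \<in> ?C" for c using tree that by (simp add: T_def)
  show ?thesis
  proof (intro conjI allI impI)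
    fix v assume v: "v \<in> ?C \<and> saturated (rooted_tree Arc cs v) ?E v"
    then show "skew_rank Arc V = skew_rank Arc (rooted_tree Arc cs v)
        + skew_rank Arc (V - rooted_tree Arc cs v)"
      using part1[of v] eq[of v] by simp
  next
    assume "\<forall>v\<in>?C. \<not> saturated (rooted_tree Arc cs v) ?E v"
    then show "skew_rank Arc V = skew_rank Arc ?C + skew_rank Arc (V - ?C)"
      by (intro part2) (simp add: eq)
  qed
qed

end
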